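(* Let $\dot G$ be a connected unbalanced signed bipartite graph on $n$ vertices. Let $r=\lfloor \frac n2\rfloor$ and $s=\lceil \frac n2\rceil$, and let $\dot G^*=(K_{r,s},\sigma^* )$ be the signed complete bipartite graph with exactly one negative edge. Then $\rho(\dot G)\le \rho(\dot G^* )$, and equality holds if and only if $\dot G$ is switching isomorphic to $\dot G^*$.
   Context: Graphs are finite and simple. A signed graph $\dot G=(G,\sigma)$ is a graph $G$ (the underlying graph) with a signature $\sigma:E(G)\to\{-1,1\}$; edges of value $-1$ are called negative. It is bipartite (connected, etc.) if $G$ is. It is balanced if every cycle contains an even number of negative edges, and unbalanced otherwise. Its adjacency matrix $A(\dot G)$ has $ij$-entry $\sigma(ij)$ if $ij\in E(G)$ and $0$ otherwise; $\rho(\dot G)$ is the spectral radius of $A(\dot G)$. Two signed graphs $(G,\sigma_1),(G,\sigma_2)$ on the same underlying graph are switching equivalent if there is $\theta:V(G)\to\{-1,1\}$ with $\sigma_2(uv)=\theta(u)\sigma_1(uv)\theta(v)$ for every edge $uv$. A signed graph is switching isomorphic to another if it is isomorphic (as a signed graph, by a sign-preserving graph isomorphism) to a signed graph switching equivalent to the other. $K_{r,s}$ is the complete bipartite graph with parts $X=\{v_1,\dots,v_r\}$ and $Y=\{w_1,\dots,w_s\}$, and $\dot G^*=(K_{r,s},\sigma^* )$ has $v_1w_1$ as its only negative edge. (An unbalanced signed bipartite graph contains a cycle of length at least $4$, so $n\ge 4$ and $2\le r\le s$.) *)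

theory Defs
  imports "Graph_Theory.Kuratowski" "Jordan_Normal_Form.Spectral_Radius"
begin

section \<open>Signed graphs\<close>

text \<open>
  A simple graph is a \<open>pair_graph\<close>: finite, loopfree, and with a symmetric set of arcs,
  the edge \<open>uv\<close> being the two arcs \<open>(u,v)\<close> and \<open>(v,u)\<close>.  A signature is evaluated on the
  unordered pair \<open>{u,v}\<close>, so that it is a function on edges; its values on other sets
  are irrelevant to every notion below.
\<close>

locale signed_graph = pair_graph G
  for G :: "'a pair_pre_digraph" and \<sigma> :: "'a set \<Rightarrow> int" +
  assumes signature: "(u, v) \<in> parcs G \<Longrightarrow> \<sigma> {u, v} \<in> {-1, 1}"

definition bipartite :: "'a pair_pre_digraph \<Rightarrow> bool" where
  "bipartite G \<longleftrightarrow> (\<exists>X Y. pverts G = X \<union> Y \<and> X \<inter> Y = {} \<and> parcs G \<subseteq> X \<times> Y \<union> Y \<times> X)"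

text \<open>
  In a symmetric digraph \<open>pre_digraph.cycle\<close> also holds of the closed walk
  \<open>[(u,v), (v,u)]\<close> along a single edge, which is not a cycle of the simple graph.
\<close>

definition graph_cycle :: "'a pair_pre_digraph \<Rightarrow> ('a \<times> 'a) list \<Rightarrow> bool" where
  "graph_cycle G p \<longleftrightarrow> pre_digraph.cycle (with_proj G) p \<and> 3 \<le> length p"

definition balanced :: "'a pair_pre_digraph \<Rightarrow> ('a set \<Rightarrow> int) \<Rightarrow> bool" where
  "balanced G \<sigma> \<longleftrightarrow>
    (\<forall>p. graph_cycle G p \<longrightarrow> even (length (filter (\<lambda>(u, v). \<sigma> {u, v} = -1) p)))"

definition switching_equivalent ::
  "'a pair_pre_digraph \<Rightarrow> ('a set \<Rightarrow> int) \<Rightarrow> ('a set \<Rightarrow> int) \<Rightarrow> bool" where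
  "switching_equivalent G \<sigma>\<^sub>1 \<sigma>\<^sub>2 \<longleftrightarrow>
    (\<exists>\<theta> :: 'a \<Rightarrow> int. (\<forall>v\<in>pverts G. \<theta> v \<in> {-1, 1}) \<and>
      (\<forall>(u, v)\<in>parcs G. \<sigma>\<^sub>2 {u, v} = \<theta> u * \<sigma>\<^sub>1 {u, v} * \<theta> v))"

definition signed_isomorphic ::
  "'a pair_pre_digraph \<Rightarrow> ('a set \<Rightarrow> int) \<Rightarrow> 'b pair_pre_digraph \<Rightarrow> ('b set \<Rightarrow> int) \<Rightarrow> bool" where
  "signed_isomorphic G \<sigma> H \<tau> \<longleftrightarrow>
    (\<exists>f. bij_betw f (pverts G) (pverts H) \<and>
      (\<forall>u\<in>pverts G. \<forall>v\<in>pverts G. (u, v) \<in> parcs G \<longleftrightarrow> (f u, f v) \<in> parcs H) \<and>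
      (\<forall>(u, v)\<in>parcs G. \<sigma> {u, v} = \<tau> {f u, f v}))"

definition switching_isomorphic ::
  "'a pair_pre_digraph \<Rightarrow> ('a set \<Rightarrow> int) \<Rightarrow> 'b pair_pre_digraph \<Rightarrow> ('b set \<Rightarrow> int) \<Rightarrow> bool" where
  "switching_isomorphic G \<sigma> H \<tau> \<longleftrightarrow>
    (\<exists>\<tau>'. signed_graph H \<tau>' \<and> switching_equivalent H \<tau>' \<tau> \<and> signed_isomorphic G \<sigma> H \<tau>')"


section \<open>Adjacency matrix and spectral radius\<close>

definition adjacency :: "'a pair_pre_digraph \<Rightarrow> ('a set \<Rightarrow> int) \<Rightarrow> 'a \<Rightarrow> 'a \<Rightarrow> complex" where
  "adjacency G \<sigma> u v = (if (u, v) \<in> parcs G then of_int (\<sigma> {u, v}) else 0)"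

text \<open>
  Matrices have rows and columns numbered from 0, so the adjacency matrix depends on a
  list \<open>vs\<close> enumerating the vertices.  The spectral radius does not, as
  \<open>rho_eq_spectral_radius\<close> shows below.
\<close>

definition adjacency_matrix ::
  "'a pair_pre_digraph \<Rightarrow> ('a set \<Rightarrow> int) \<Rightarrow> 'a list \<Rightarrow> complex mat" where
  "adjacency_matrix G \<sigma> vs =
    mat (length vs) (length vs) (\<lambda>(i, j). adjacency G \<sigma> (vs ! i) (vs ! j))"

definition vertex_list :: "'a pair_pre_digraph \<Rightarrow> 'a list" where
  "vertex_list G = (SOME vs. distinct vs \<and> set vs = pverts G)"

definition rho :: "'a pair_pre_digraph \<Rightarrow> ('a set \<Rightarrow> int) \<Rightarrow> real" where
  "rho G \<sigma> = spectral_radius (adjacency_matrix G \<sigma> (vertex_list G))"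

lemma eigenvalue_adjacency_matrix_iff:
  assumes "distinct vs"
  shows "eigenvalue (adjacency_matrix G \<sigma> vs) k \<longleftrightarrow>
    (\<exists>x. (\<exists>v\<in>set vs. x v \<noteq> 0) \<and>
      (\<forall>u\<in>set vs. (\<Sum>v\<in>set vs. adjacency G \<sigma> u v * x v) = k * x u))"
    (is "?L \<longleftrightarrow> ?R")
proof -
  let ?n = "length vs" and ?A = "adjacency_matrix G \<sigma> vs"
  have dim: "dim_row ?A = ?n" "dim_col ?A = ?n"
    by (simp_all add: adjacency_matrix_def)
  have bij: "bij_betw ((!) vs) {0..<?n} (set vs)"
    using bij_betw_nth[OF assms] by (simp add: atLeast0LessThan)
  have mult: "(?A *\<^sub>v vec ?n (\<lambda>i. x (vs ! i))) $ i
      = (\<Sum>v\<in>set vs. adjacency G \<sigma> (vs ! i) v * x v)" if "i < ?n" for i x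
  proof -
    have "(?A *\<^sub>v vec ?n (\<lambda>i. x (vs ! i))) $ i
        = (\<Sum>j\<in>{0..<?n}. adjacency G \<sigma> (vs ! i) (vs ! j) * x (vs ! j))"
      using that by (auto simp: adjacency_matrix_def scalar_prod_def intro!: sum.cong)
    also have "\<dots> = (\<Sum>v\<in>set vs. adjacency G \<sigma> (vs ! i) v * x v)"
      by (rule sum.reindex_bij_betw[OF bij])
    finally show ?thesis .
  qed
  have ev: "eigenvector ?A (vec ?n (\<lambda>i. x (vs ! i))) k \<longleftrightarrow>
      (\<exists>v\<in>set vs. x v \<noteq> 0) \<and>
      (\<forall>u\<in>set vs. (\<Sum>v\<in>set vs. adjacency G \<sigma> u v * x v) = k * x u)" for x
  proof -
    have nonzero: "vec ?n (\<lambda>i. x (vs ! i)) \<noteq> 0\<^sub>v ?n \<longleftrightarrow> (\<exists>v\<in>set vs. x v \<noteq> 0)"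
      by (auto simp: vec_eq_iff in_set_conv_nth intro: bexI[OF _ nth_mem])
    have eq: "?A *\<^sub>v vec ?n (\<lambda>i. x (vs ! i)) = k \<cdot>\<^sub>v vec ?n (\<lambda>i. x (vs ! i)) \<longleftrightarrow>
        (\<forall>i<?n. (\<Sum>v\<in>set vs. adjacency G \<sigma> (vs ! i) v * x v) = k * x (vs ! i))"
    proof -
      have "?A *\<^sub>v vec ?n (\<lambda>i. x (vs ! i)) = k \<cdot>\<^sub>v vec ?n (\<lambda>i. x (vs ! i)) \<longleftrightarrow>
          (\<forall>i<?n. (?A *\<^sub>v vec ?n (\<lambda>i. x (vs ! i))) $ i = k * x (vs ! i))"
        by (subst vec_eq_iff) (simp add: dim del: index_mult_mat_vec)
      also have "\<dots> \<longleftrightarrow>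
          (\<forall>i<?n. (\<Sum>v\<in>set vs. adjacency G \<sigma> (vs ! i) v * x v) = k * x (vs ! i))"
        using mult by metis
      finally show ?thesis .
    qed
    show ?thesis
      by (simp only: eigenvector_def dim nonzero eq all_set_conv_all_nth vec_carrier simp_thms)
  qed
  show ?thesis
  proof
    assume ?L
    then obtain w where w: "eigenvector ?A w k" by (auto simp: eigenvalue_def)
    define x where "x v = w $ (inv_into {0..<?n} ((!) vs) v)" for v
    have "w = vec ?n (\<lambda>i. x (vs ! i))"
      using w bij_betw_inv_into_left[OF bij] by (auto simp: eigenvector_def dim x_def)
    with w ev[of x] show ?R by metis
  next
    assume ?R
    then show ?L using ev by (auto simp: eigenvalue_def)
  qed
qed

lemma rho_eq_spectral_radius:
  assumes "distinct vs" "set vs = pverts G"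
  shows "rho G \<sigma> = spectral_radius (adjacency_matrix G \<sigma> vs)"
proof -
  have "distinct (vertex_list G) \<and> set (vertex_list G) = pverts G"
    unfolding vertex_list_def by (rule someI[of _ vs]) (use assms in simp)
  then have vs: "distinct (vertex_list G)" "set (vertex_list G) = pverts G" by auto
  have "spectrum (adjacency_matrix G \<sigma> (vertex_list G))
      = spectrum (adjacency_matrix G \<sigma> vs)"
    unfolding spectrum_def eigenvalue_adjacency_matrix_iff[OF vs(1)]
      eigenvalue_adjacency_matrix_iff[OF assms(1)] vs(2) assms(2) ..
  then show ?thesis by (simp add: rho_def spectral_radius_def)
qed


section \<open>The signed complete bipartite graph with one negative edge\<close>

text \<open>The vertices \<open>v\<^sub>i\<close> and \<open>w\<^sub>j\<close> are \<open>Inl i\<close> and \<open>Inr j\<close>.\<close>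

definition complete_bipartite :: "nat \<Rightarrow> nat \<Rightarrow> (nat + nat) pair_pre_digraph" where
  "complete_bipartite r s =
    \<lparr> pverts = Inl ` {1..r} \<union> Inr ` {1..s},
      parcs = (Inl ` {1..r}) \<times> (Inr ` {1..s}) \<union> (Inr ` {1..s}) \<times> (Inl ` {1..r}) \<rparr>"

definition star_signature :: "(nat + nat) set \<Rightarrow> int" where
  "star_signature e = (if e = {Inl 1, Inr 1} then -1 else 1)"

lemma complete_bipartite_digraph_complete_bipartite:
  "complete_bipartite_digraph r s (with_proj (complete_bipartite r s))"
  unfolding complete_bipartite_digraph_pair_def
  by (intro conjI exI[of _ "Inl ` {1..r}"] exI[of _ "Inr ` {1..s}"])
    (auto simp: complete_bipartite_def card_image)

lemma signed_graph_star: "signed_graph (complete_bipartite r s) star_signature"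
  by unfold_locales
    (auto simp: complete_bipartite_def star_signature_def arc_to_ends_def symmetric_def
      intro!: symI)

lemma bipartite_complete_bipartite: "bipartite (complete_bipartite r s)"
  unfolding bipartite_def
  by (intro exI[of _ "Inl ` {1..r}"] exI[of _ "Inr ` {1..s}"])
    (auto simp: complete_bipartite_def)

lemma not_balanced_star:
  assumes "2 \<le> r" "2 \<le> s"
  shows "\<not> balanced (complete_bipartite r s) star_signature"
proof -
  let ?G = "complete_bipartite r s"
  let ?p = "[(Inl 1, Inr 1), (Inr 1, Inl 2), (Inl 2, Inr 2), (Inr 2, Inl 1)]
    :: ((nat + nat) \<times> (nat + nat)) list"
  have "pre_digraph.cycle (with_proj ?G) ?p"
    unfolding pre_digraph.cycle_def pre_digraph.awalk_def cas_with_proj_eq awalk_verts_with_proj_eq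
    using assms by (intro exI[of _ "Inl 1"]) (simp add: complete_bipartite_def)
  then have "graph_cycle ?G ?p" by (simp add: graph_cycle_def)
  moreover have "length (filter (\<lambda>(u, v). star_signature {u, v} = -1) ?p) = 1"
    by (simp add: star_signature_def doubleton_eq_iff)
  ultimately show ?thesis unfolding balanced_def by (metis odd_one)
qed

end

theory Submission
  imports Defs
begin

text \<open>
  Let \<open>X\<close> and \<open>Y\<close> be the parts of \<open>G\<close>, with \<open>p\<close> and \<open>q\<close> vertices.  The adjacency matrix is real
  symmetric and bipartite, so \<open>rho G \<sigma>\<close> is an eigenvalue with a real eigenvector, and a switching
  by the signs of its entries makes this eigenvector nonnegative
  (\<open>obtain_nonneg_switched_eigenvector\<close>).  Switching preserves unbalance, so some edge
  \<open>u\<^sub>0v\<^sub>0\<close> is still negative (\<open>balanced_if_switching_all_positive\<close>).  Hence the switched matrix is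
  bounded entrywise by that of \<open>K\<^bsub>p,q\<^esub>\<close> with \<open>u\<^sub>0v\<^sub>0\<close> as its only negative edge, and a nonnegative
  vector sees only this comparison.

  The comparison matrix has a quotient of size four: the entries of the vector at \<open>u\<^sub>0\<close> and \<open>v\<^sub>0\<close> and
  its sums over the rest of \<open>X\<close> and of \<open>Y\<close>.  They satisfy four linear inequalities, which
  \<open>quotient_inequalities\<close> turns into \<open>(rho G \<sigma>)\<^sup>2 \<le> top_sq p q\<close>, where \<open>top_sq p q\<close> is the larger
  root of \<open>t\<^sup>2 - p q t + 4 (p - 1) (q - 1)\<close>.  If the bound is attained, all the inequalities are
  equalities, which forces the switched matrix to be the comparison matrix itself
  (\<open>bipartite_eigenvector.extremal_entry\<close>); so \<open>G\<close> is switching isomorphic to \<open>K\<^bsub>p,q\<^esub>\<close> with one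
  negative edge.

  For fixed \<open>p + q\<close> the value \<open>top_sq p q\<close> increases with \<open>p q\<close>, hence is largest exactly for
  parts of sizes \<open>r\<close> and \<open>s\<close> (\<open>top_sq_le_equal_parts\<close>).  Conversely, the quotient of
  \<open>K\<^bsub>r,s\<^esub>\<close> has an eigenvector with eigenvalue \<open>sqrt (top_sq r s)\<close>, and it can be carried along a
  switching isomorphism (\<open>rho_ge_if_switching_isomorphic_star\<close>).
\<close>

section \<open>The quotient matrix of a complete bipartite graph with one negative edge\<close>

text \<open>
  The largest squared singular value of the \<open>p \<times> q\<close> matrix with one entry \<open>-1\<close> and all other
  entries \<open>1\<close>.  That matrix has rank at most two; its squared singular values add up to \<open>p q\<close>, and
  their product is the sum of its squared \<open>2 \<times> 2\<close> minors.  The nonzero ones are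
  the \<open>(p - 1) (q - 1)\<close> minors through the negative entry, each equal to \<open>\<plusminus>2\<close>.
\<close>

definition top_sq :: "real \<Rightarrow> real \<Rightarrow> real" where
  "top_sq p q = (p * q + sqrt ((p * q)\<^sup>2 - 16 * (p - 1) * (q - 1))) / 2"

lemma top_sq_commute: "top_sq p q = top_sq q p"
  by (simp add: top_sq_def algebra_simps)

lemma discriminant_nonneg:
  fixes p q :: real
  assumes "2 \<le> p" "2 \<le> q"
  shows "0 \<le> (p * q)\<^sup>2 - 16 * (p - 1) * (q - 1)"
proof -
  have "4 * (x - 1) \<le> x\<^sup>2" for x :: real
    using zero_le_power2[of "x - 2"] by (simp add: power2_eq_square algebra_simps)
  then have "(4 * (p - 1)) * (4 * (q - 1)) \<le> p\<^sup>2 * q\<^sup>2"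
    using assms by (intro mult_mono) auto
  then show ?thesis by (simp add: power_mult_distrib algebra_simps)
qed

text \<open>
  The quadratic equation for \<open>top_sq p q\<close>, rearranged so that it says that the quadratic form in
  \<open>quotient_norm_bound\<close> has determinant zero.
\<close>

lemma top_sq_factorization:
  assumes "2 \<le> p" "2 \<le> q"
  shows "(top_sq p q - p) * (top_sq p q - p * (q - 1)) = (q - 1) * (p - 2)\<^sup>2"
proof -
  define d where "d = sqrt ((p * q)\<^sup>2 - 16 * (p - 1) * (q - 1))"
  have "d\<^sup>2 = (p * q)\<^sup>2 - 16 * (p - 1) * (q - 1)"
    using discriminant_nonneg[OF assms] by (simp add: d_def)
  moreover have "d = 2 * top_sq p q - p * q" by (simp add: top_sq_def d_def add_divide_distrib)
  ultimately have "(2 * top_sq p q - p * q)\<^sup>2 = (p * q)\<^sup>2 - 16 * (p - 1) * (q - 1)" by simp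
  then show ?thesis by (simp add: power2_eq_square algebra_simps)
qed

lemma top_sq_ge:
  assumes "2 \<le> p" "2 \<le> q"
  shows "p \<le> top_sq p q" "p * (q - 1) \<le> top_sq p q" "0 < top_sq p q"
proof -
  let ?a = "top_sq p q - p" and ?b = "top_sq p q - p * (q - 1)"
  have "p * q / 2 \<le> top_sq p q"
    using discriminant_nonneg[OF assms] by (simp add: top_sq_def)
  then have sum: "0 \<le> ?a + ?b" by (simp add: algebra_simps)
  have prod: "0 \<le> ?a * ?b" using assms by (simp add: top_sq_factorization)
  \<comment> \<open>two reals with nonnegative sum and nonnegative product are nonnegative\<close>
  have "0 \<le> ?a \<and> 0 \<le> ?b" using sum prod by (auto simp: zero_le_mult_iff)
  then show "p \<le> top_sq p q" "p * (q - 1) \<le> top_sq p q" by auto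
  then show "0 < top_sq p q" using assms by linarith
qed

lemma singular_form_nonneg:
  fixes \<alpha> \<beta> \<gamma> x y :: real
  assumes "0 \<le> \<alpha>" "0 \<le> \<gamma>" "\<alpha> * \<gamma> = \<beta>\<^sup>2" "0 \<le> \<beta>"
  shows "2 * \<beta> * x * y \<le> \<alpha> * x\<^sup>2 + \<gamma> * y\<^sup>2"
proof -
  have "\<beta> = sqrt \<alpha> * sqrt \<gamma>" using assms by (metis real_sqrt_mult real_sqrt_abs abs_of_nonneg)
  moreover have "0 \<le> (sqrt \<alpha> * x - sqrt \<gamma> * y)\<^sup>2" by simp
  ultimately show ?thesis
    using assms by (simp add: power2_diff power_mult_distrib algebra_simps)
qed

text \<open>
  This is \<open>\<parallel>B y\<parallel>\<^sup>2 \<le> t \<parallel>y\<parallel>\<^sup>2\<close> for the matrix \<open>B\<close> of \<open>K\<^bsub>p,q\<^esub>\<close> with one negative edge, where \<open>y\<close>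
  has the entry \<open>b\<close> at \<open>v\<^sub>0\<close> and is constant with sum \<open>T\<close> on the rest of \<open>Y\<close>: then \<open>B y\<close> is \<open>T - b\<close>
  at \<open>u\<^sub>0\<close> and \<open>T + b\<close> elsewhere.  The difference of the two sides is a quadratic form in \<open>b\<close> and
  \<open>T\<close> with nonnegative diagonal and determinant zero.
\<close>

lemma quotient_norm_bound:
  assumes "2 \<le> p" "2 \<le> q"
  shows "(T - b)\<^sup>2 + (p - 1) * (T + b)\<^sup>2 \<le> top_sq p q * (b\<^sup>2 + T\<^sup>2 / (q - 1))"
proof -
  define t where "t = top_sq p q"
  have q: "q - 1 > 0" using assms by simp
  have "(t - p) * (t / (q - 1) - p) = (t - p) * (t - p * (q - 1)) / (q - 1)"
    using q by (simp add: field_simps)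
  also have "\<dots> = (p - 2)\<^sup>2"
    using q by (simp add: t_def top_sq_factorization[OF assms])
  finally have det: "(t - p) * (t / (q - 1) - p) = (p - 2)\<^sup>2" .
  have "p \<le> t / (q - 1)" using top_sq_ge[OF assms] q by (simp add: t_def pos_le_divide_eq)
  then have "2 * (p - 2) * b * T \<le> (t - p) * b\<^sup>2 + (t / (q - 1) - p) * T\<^sup>2"
    using assms top_sq_ge[OF assms] det by (intro singular_form_nonneg) (auto simp: t_def)
  then show ?thesis unfolding t_def by (simp add: power2_eq_square algebra_simps)
qed

text \<open>
  Squaring the inequalities for the \<open>X\<close>-side (possible, as both sides are nonnegative) bounds
  \<open>\<rho>\<^sup>2 M\<close> by the squared norm in \<open>quotient_norm_bound\<close>, so by \<open>t N\<close>, where \<open>M\<close> and \<open>N\<close> are the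
  weighted squared norms of \<open>(a, S)\<close> and \<open>(b, T)\<close>; symmetrically \<open>\<rho>\<^sup>2 N \<le> t M\<close>.  Adding the two
  gives \<open>\<rho>\<^sup>2 \<le> t\<close>, and if \<open>\<rho>\<^sup>2 = t\<close> nothing may be lost on the way, not even in the inequalities
  for an entry at which the top eigenvector of \<open>K\<^bsub>p,q\<^esub>\<close> vanishes (this happens
  for \<open>p = 2 < q\<close>).
\<close>

lemma quotient_inequalities:
  fixes p q \<rho> a b S T :: real
  assumes pq: "2 \<le> p" "2 \<le> q" and \<rho>: "0 \<le> \<rho>"
    and nonneg: "0 \<le> a" "0 \<le> b" "0 \<le> S" "0 \<le> T"
    and nonzero: "a \<noteq> 0 \<or> b \<noteq> 0 \<or> S \<noteq> 0 \<or> T \<noteq> 0"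
    and a: "\<rho> * a \<le> T - b" and b: "\<rho> * b \<le> S - a"
    and S: "\<rho> * S \<le> (p - 1) * (T + b)" and T: "\<rho> * T \<le> (q - 1) * (S + a)"
  shows "\<rho>\<^sup>2 \<le> top_sq p q"
    and "\<rho>\<^sup>2 = top_sq p q \<Longrightarrow> \<rho> * a = T - b \<and> \<rho> * S = (p - 1) * (T + b)"
proof -
  define t where "t = top_sq p q"
  define M where "M = a\<^sup>2 + S\<^sup>2 / (p - 1)"
  define N where "N = b\<^sup>2 + T\<^sup>2 / (q - 1)"
  have weighted: "(\<rho> * c)\<^sup>2 + (\<rho> * R)\<^sup>2 / (m - 1) = \<rho>\<^sup>2 * (c\<^sup>2 + R\<^sup>2 / (m - 1))" for c R m
    by (simp add: power_mult_distrib distrib_left)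
  have square: "((m - 1) * Q)\<^sup>2 / (m - 1) = (m - 1) * Q\<^sup>2" if "2 \<le> m" for m Q :: real
    using that by (simp add: power2_eq_square)
  have sq_a: "(\<rho> * a)\<^sup>2 \<le> (T - b)\<^sup>2" and sq_b: "(\<rho> * b)\<^sup>2 \<le> (S - a)\<^sup>2"
    using a b \<rho> nonneg by (intro power_mono; simp)+
  have sq_S: "(\<rho> * S)\<^sup>2 / (p - 1) \<le> (p - 1) * (T + b)\<^sup>2"
    and sq_T: "(\<rho> * T)\<^sup>2 / (q - 1) \<le> (q - 1) * (S + a)\<^sup>2"
    unfolding square[OF pq(1), symmetric] square[OF pq(2), symmetric]
    using S T \<rho> nonneg pq by (intro divide_right_mono power_mono; simp)+
  have M_le: "\<rho>\<^sup>2 * M \<le> (T - b)\<^sup>2 + (p - 1) * (T + b)\<^sup>2"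
    unfolding M_def weighted[symmetric] using sq_a sq_S by linarith
  have N_le: "\<rho>\<^sup>2 * N \<le> (S - a)\<^sup>2 + (q - 1) * (S + a)\<^sup>2"
    unfolding N_def weighted[symmetric] using sq_b sq_T by linarith
  have bound_N: "(T - b)\<^sup>2 + (p - 1) * (T + b)\<^sup>2 \<le> t * N"
    unfolding t_def N_def by (rule quotient_norm_bound[OF pq])
  have bound_M: "(S - a)\<^sup>2 + (q - 1) * (S + a)\<^sup>2 \<le> t * M"
    unfolding t_def M_def top_sq_commute[of p] by (rule quotient_norm_bound[OF pq(2,1)])
  have parts: "0 \<le> S\<^sup>2 / (p - 1)" "0 \<le> T\<^sup>2 / (q - 1)" using pq by auto
  have "M + N \<noteq> 0"
  proof
    assume "M + N = 0"
    then have "a\<^sup>2 = 0" "b\<^sup>2 = 0" "S\<^sup>2 / (p - 1) = 0" "T\<^sup>2 / (q - 1) = 0"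
      using parts zero_le_power2[of a] zero_le_power2[of b] unfolding M_def N_def by linarith+
    then show False using nonzero pq by auto
  qed
  moreover have "0 \<le> M" "0 \<le> N" using parts by (simp_all add: M_def N_def)
  ultimately have pos: "0 < M + N" by linarith
  have "\<rho>\<^sup>2 * (M + N) \<le> t * (M + N)"
    using M_le N_le bound_M bound_N by (simp add: distrib_left)
  then show "\<rho>\<^sup>2 \<le> top_sq p q" using pos by (simp add: t_def)
  assume "\<rho>\<^sup>2 = top_sq p q"
  then have "\<rho>\<^sup>2 * M + \<rho>\<^sup>2 * N = t * M + t * N" by (simp add: t_def)
  then have "\<rho>\<^sup>2 * M = (T - b)\<^sup>2 + (p - 1) * (T + b)\<^sup>2"
    using M_le N_le bound_M bound_N by linarith
  then have eq: "(\<rho> * a)\<^sup>2 = (T - b)\<^sup>2" "(\<rho> * S)\<^sup>2 / (p - 1) = (p - 1) * (T + b)\<^sup>2"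
    unfolding M_def weighted[symmetric] using sq_a sq_S by linarith+
  have "0 \<le> \<rho> * a" "0 \<le> \<rho> * S" using \<rho> nonneg by auto
  moreover have "(\<rho> * S)\<^sup>2 = ((p - 1) * (T + b))\<^sup>2"
    using eq(2) pq unfolding square[OF pq(1), symmetric] by simp
  ultimately show "\<rho> * a = T - b \<and> \<rho> * S = (p - 1) * (T + b)"
    using eq(1) a S by (auto intro: power2_eq_imp_eq)
qed

text \<open>
  An eigenvector of the quotient, with the entries \<open>a\<close> and \<open>b\<close> at the ends of the negative edge and
  \<open>c\<close> and \<open>d\<close> on the rest of the two parts.  Eliminating \<open>a\<close> and \<open>c\<close> leaves two linear equations
  for \<open>b\<close> and \<open>d\<close>, whose determinant vanishes by \<open>top_sq_factorization\<close>.
\<close>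

lemma quotient_eigenvector:
  assumes pq: "2 \<le> p" "2 \<le> q" and \<rho>: "\<rho> = sqrt (top_sq p q)"
  obtains a b c d where "a \<noteq> 0 \<or> b \<noteq> 0 \<or> c \<noteq> 0 \<or> d \<noteq> 0"
    "\<rho> * a = (q - 1) * d - b" "\<rho> * c = (q - 1) * d + b"
    "\<rho> * b = (p - 1) * c - a" "\<rho> * d = (p - 1) * c + a"
proof -
  define t where "t = top_sq p q"
  have \<rho>_pos: "0 < \<rho>" and \<rho>_sq: "t = \<rho> * \<rho>" using top_sq_ge[OF pq] by (simp_all add: \<rho> t_def)
  have fact: "(t - p) * (t - p * (q - 1)) = (q - 1) * (p - 2)\<^sup>2"
    unfolding t_def by (rule top_sq_factorization[OF pq])
  obtain b d where bd: "b \<noteq> 0 \<or> d \<noteq> 0"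
    and b: "(t - p) * b = (p - 2) * (q - 1) * d" and d: "(t - p * (q - 1)) * d = (p - 2) * b"
  proof (cases "p = 2")
    case True
    \<comment> \<open>the general solution below is zero if \<open>p = 2\<close>\<close>
    then have "t = p \<or> t = p * (q - 1)" using fact by auto
    moreover have "p \<le> p * (q - 1)" using pq by simp
    ultimately have "t = p * (q - 1)" using top_sq_ge[OF pq] by (auto simp: t_def)
    then show ?thesis using True by (intro that[of 0 1]) auto
  next
    case False
    then show ?thesis
      using fact by (intro that[of "t - p * (q - 1)" "p - 2"]) (auto simp: power2_eq_square)
  qed
  define a where "a = ((q - 1) * d - b) / \<rho>"
  define c where "c = ((q - 1) * d + b) / \<rho>"
  have a: "\<rho> * a = (q - 1) * d - b" and c: "\<rho> * c = (q - 1) * d + b"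
    using \<rho>_pos by (simp_all add: a_def c_def)
  have "\<rho> * (\<rho> * b) = (p - 1) * (\<rho> * c) - \<rho> * a"
    unfolding a c using b \<rho>_sq by (simp add: algebra_simps)
  then have "\<rho> * (\<rho> * b) = \<rho> * ((p - 1) * c - a)" by (simp add: algebra_simps)
  moreover have "\<rho> * (\<rho> * d) = (p - 1) * (\<rho> * c) + \<rho> * a"
    unfolding a c using d \<rho>_sq by (simp add: algebra_simps)
  then have "\<rho> * (\<rho> * d) = \<rho> * ((p - 1) * c + a)" by (simp add: algebra_simps)
  ultimately show ?thesis using bd a c \<rho>_pos by (intro that[of a b c d]) auto
qed

text \<open>
  For a fixed sum \<open>n = p + q\<close>, the discriminant is \<open>P\<^sup>2 - 16 P + 16 (n - 1)\<close> with \<open>P = p q\<close>, which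
  increases from \<open>P = 8\<close> on.
\<close>

lemma top_sq_strict_mono:
  fixes p q p' q' :: real
  assumes sum: "p + q = p' + q'" and prod: "p * q < p' * q'" and large: "8 \<le> p * q"
    and ge: "2 \<le> p" "2 \<le> q"
  shows "top_sq p q < top_sq p' q'"
proof -
  let ?d = "\<lambda>p q :: real. (p * q)\<^sup>2 - 16 * (p - 1) * (q - 1)"
  have "?d p' q' - ?d p q = (p' * q' - p * q) * (p' * q' + p * q - 16)"
  proof -
    have "(p' - 1) * (q' - 1) = p' * q' - (p + q) + 1" using sum by (simp add: algebra_simps)
    moreover have "(p - 1) * (q - 1) = p * q - (p + q) + 1" by (simp add: algebra_simps)
    ultimately show ?thesis by (simp add: mult.assoc) (simp add: power2_eq_square algebra_simps)
  qed
  moreover have "0 < (p' * q' - p * q) * (p' * q' + p * q - 16)"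
    using prod large by (intro mult_pos_pos) auto
  ultimately have "?d p q < ?d p' q'" by linarith
  then have "sqrt (?d p q) < sqrt (?d p' q')" by (rule real_sqrt_less_mono)
  then show ?thesis unfolding top_sq_def using prod
    by (intro divide_strict_right_mono add_strict_mono) auto
qed

lemma top_sq_le_equal_parts:
  fixes p q r s :: nat
  assumes sum: "p + q = r + s" and bal: "r \<le> s" "s \<le> r + 1" and pq: "2 \<le> p" "2 \<le> q"
  shows "top_sq p q \<le> top_sq r s"
    and "top_sq p q = top_sq r s \<Longrightarrow> (p = r \<and> q = s) \<or> (p = s \<and> q = r)"
proof -
  have key: "(p = r \<and> q = s) \<or> (p = s \<and> q = r) \<or> top_sq p q < top_sq r s"
  proof (rule ccontr)
    assume neg: "\<not> ?thesis"
    \<comment> \<open>if the smaller part has fewer than \<open>r\<close> vertices, then the larger one has at least 4, so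
      that the product of the sizes is at least 8\<close>
    have main: False if "p' + q' = r + s" "p' < r" "2 \<le> p'" "top_sq p' q' \<ge> top_sq r s"
      for p' q' :: nat
    proof -
      define k where "k = r - p'"
      have k: "r = p' + k" "q' = s + k" "0 < k" using that bal by (auto simp: k_def)
      have "r * s = p' * q' + k * (s - p')"
      proof -
        obtain m where "s = p' + m" using k bal by (metis le_add_diff_inverse add_leD1)
        then show ?thesis using k by (simp add: algebra_simps)
      qed
      moreover have "0 < k * (s - p')" using k bal by auto
      ultimately have "p' * q' < r * s" by linarith
      then have "real p' * real q' < real r * real s" by (metis of_nat_less_iff of_nat_mult)
      moreover have "2 * 4 \<le> p' * q'" using that k bal by (intro mult_mono) auto
      then have "8 \<le> real p' * real q'" by (metis mult_2 numeral_Bit0 of_nat_le_iff of_nat_mult of_nat_numeral)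
      ultimately have "top_sq p' q' < top_sq r s"
        using that k bal by (intro top_sq_strict_mono) auto
      then show False using that by simp
    qed
    have "p < r \<or> q < r" using neg sum bal by linarith
    then show False
      using main[of p q] main[of q p] neg sum pq by (auto simp: top_sq_commute add.commute)
  qed
  then show "top_sq p q \<le> top_sq r s" using top_sq_commute[of p q] by auto
  assume "top_sq p q = top_sq r s"
  then show "(p = r \<and> q = s) \<or> (p = s \<and> q = r)" using key by auto
qed

section \<open>Nonnegative eigenvectors of a bipartite signed matrix\<close>

lemma sum_mult_le_total:
  fixes c f :: "'a \<Rightarrow> real"
  assumes "\<And>j. j \<in> A \<Longrightarrow> c j \<le> 1" "\<And>j. j \<in> A \<Longrightarrow> 0 \<le> f j"
  shows "(\<Sum>j\<in>A. c j * f j) \<le> (\<Sum>j\<in>A. f j)"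
proof (rule sum_mono)
  fix j assume "j \<in> A"
  then show "c j * f j \<le> f j" using assms mult_right_mono[of "c j" 1 "f j"] by simp
qed

lemma sum_le_total_minus_twice:
  fixes c f :: "'a \<Rightarrow> real"
  assumes "finite A" "i \<in> A" "c i = -1" "\<And>j. j \<in> A \<Longrightarrow> c j \<le> 1" "\<And>j. j \<in> A \<Longrightarrow> 0 \<le> f j"
  shows "(\<Sum>j\<in>A. c j * f j) \<le> (\<Sum>j\<in>A - {i}. f j) - f i"
proof -
  have "(\<Sum>j\<in>A. c j * f j) = (\<Sum>j\<in>A - {i}. c j * f j) - f i"
    using assms by (subst sum.remove[of A i]) auto
  also have "(\<Sum>j\<in>A - {i}. c j * f j) \<le> (\<Sum>j\<in>A - {i}. f j)"
    using assms by (intro sum_mult_le_total) auto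
  finally show ?thesis by simp
qed

lemma coefficient_one_if_total:
  fixes c f :: "'a \<Rightarrow> real"
  assumes "finite A" "\<And>j. j \<in> A \<Longrightarrow> c j \<le> 1" "\<And>j. j \<in> A \<Longrightarrow> 0 \<le> f j"
    and eq: "(\<Sum>j\<in>A. c j * f j) = (\<Sum>j\<in>A. f j)" and j: "j \<in> A" "0 < f j"
  shows "c j = 1"
proof -
  have "(\<Sum>j\<in>A. (1 - c j) * f j) = 0" using eq by (simp add: left_diff_distrib sum_subtractf)
  then have "(1 - c j) * f j = 0"
    using assms by (subst (asm) sum_nonneg_eq_0_iff) auto
  then show ?thesis using j by simp
qed

text \<open>
  The situation after switching: \<open>B\<close> is the block of the adjacency matrix with rows \<open>X\<close> and columns
  \<open>Y\<close>, and \<open>z\<close> is a nonnegative eigenvector.  The assumptions are symmetric in \<open>X\<close> and \<open>Y\<close>, so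
  everything proved for rows also holds for columns.
\<close>

locale bipartite_eigenvector =
  fixes X Y :: "'a set" and u\<^sub>0 v\<^sub>0 :: 'a and B :: "'a \<Rightarrow> 'a \<Rightarrow> real" and z :: "'a \<Rightarrow> real" and \<rho> :: real
  assumes finite: "finite X" "finite Y" and two: "2 \<le> card X" "2 \<le> card Y"
    and in_parts: "u\<^sub>0 \<in> X" "v\<^sub>0 \<in> Y"
    and le_one: "u \<in> X \<Longrightarrow> v \<in> Y \<Longrightarrow> B u v \<le> 1" and negative: "B u\<^sub>0 v\<^sub>0 = -1"
    and nonneg: "0 \<le> z w" "0 \<le> \<rho>" and nonzero: "\<exists>w\<in>X \<union> Y. z w \<noteq> 0"
    and eigen_X: "u \<in> X \<Longrightarrow> (\<Sum>v\<in>Y. B u v * z v) = \<rho> * z u"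
    and eigen_Y: "v \<in> Y \<Longrightarrow> (\<Sum>u\<in>X. B u v * z u) = \<rho> * z v"
begin

lemma transposed: "bipartite_eigenvector Y X v\<^sub>0 u\<^sub>0 (\<lambda>u v. B v u) z \<rho>"
  using finite two in_parts le_one negative nonneg nonzero eigen_X eigen_Y
  by unfold_locales (auto simp: Un_commute)

abbreviation "S \<equiv> \<Sum>u\<in>X - {u\<^sub>0}. z u"
abbreviation "T \<equiv> \<Sum>v\<in>Y - {v\<^sub>0}. z v"

lemma total_Y: "(\<Sum>v\<in>Y. z v) = T + z v\<^sub>0"
  using finite in_parts by (subst sum.remove[of _ v\<^sub>0]) auto

lemma negative_row: "\<rho> * z u\<^sub>0 \<le> T - z v\<^sub>0"
  unfolding eigen_X[OF in_parts(1), symmetric]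
  using finite in_parts le_one negative nonneg by (intro sum_le_total_minus_twice) auto

lemma positive_row: "u \<in> X \<Longrightarrow> \<rho> * z u \<le> T + z v\<^sub>0"
  unfolding eigen_X[symmetric] total_Y[symmetric]
  using le_one nonneg by (intro sum_mult_le_total) auto

lemma card_others: "real (card (X - {u\<^sub>0})) = real (card X) - 1"
  using finite in_parts two by (simp add: card_Diff_singleton of_nat_diff)

lemma positive_rows: "\<rho> * S \<le> (real (card X) - 1) * (T + z v\<^sub>0)"
proof -
  have "\<rho> * S \<le> (\<Sum>u\<in>X - {u\<^sub>0}. T + z v\<^sub>0)"
    unfolding sum_distrib_left using positive_row by (intro sum_mono) auto
  then show ?thesis by (simp add: card_others[symmetric])
qed

lemma sums_nonneg: "0 \<le> S" "0 \<le> T"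
  using nonneg by (auto intro: sum_nonneg)

lemma sums_nonzero: "z u\<^sub>0 \<noteq> 0 \<or> z v\<^sub>0 \<noteq> 0 \<or> S \<noteq> 0 \<or> T \<noteq> 0"
proof -
  have "\<exists>w. w \<in> X - {u\<^sub>0} \<and> z w \<noteq> 0 \<or> w \<in> Y - {v\<^sub>0} \<and> z w \<noteq> 0" if "z u\<^sub>0 = 0" "z v\<^sub>0 = 0"
    using nonzero that by auto
  then show ?thesis
    using finite nonneg by (auto simp: sum_nonneg_eq_0_iff)
qed

lemmas quotient = quotient_inequalities[of "real (card X)" "real (card Y)" \<rho> "z u\<^sub>0" "z v\<^sub>0" S T]

lemma eigenvalue_bound: "\<rho>\<^sup>2 \<le> top_sq (card X) (card Y)"
  using two nonneg sums_nonneg sums_nonzero negative_row positive_rows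
    bipartite_eigenvector.negative_row[OF transposed] bipartite_eigenvector.positive_rows[OF transposed]
  by (intro quotient(1)) auto

text \<open>
  Equality in the sum of the row inequalities gives equality in each of them: \<open>z\<close> is also an
  eigenvector of the comparison matrix.
\<close>

lemma extremal_row_sums:
  assumes "\<rho>\<^sup>2 = top_sq (card X) (card Y)"
  shows "\<rho> * z u\<^sub>0 = T - z v\<^sub>0" and "u \<in> X - {u\<^sub>0} \<Longrightarrow> \<rho> * z u = T + z v\<^sub>0"
proof -
  have eq: "\<rho> * z u\<^sub>0 = T - z v\<^sub>0 \<and> \<rho> * S = (real (card X) - 1) * (T + z v\<^sub>0)"
    using two nonneg sums_nonneg sums_nonzero negative_row positive_rows assms
      bipartite_eigenvector.negative_row[OF transposed] bipartite_eigenvector.positive_rows[OF transposed]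
    by (intro quotient(2)) auto
  then show "\<rho> * z u\<^sub>0 = T - z v\<^sub>0" by simp
  assume u: "u \<in> X - {u\<^sub>0}"
  have "(\<Sum>u\<in>X - {u\<^sub>0}. (T + z v\<^sub>0) - \<rho> * z u) = 0"
    using eq by (simp add: sum_subtractf sum_distrib_left[symmetric] card_others[symmetric])
  then show "\<rho> * z u = T + z v\<^sub>0"
    using u finite positive_row by (subst (asm) sum_nonneg_eq_0_iff) auto
qed

text \<open>
  All rows of the comparison matrix other than \<open>u\<^sub>0\<close> are constant \<open>1\<close>, so if \<open>z\<close> vanishes at one of
  them, then it vanishes on \<open>Y\<close> and thus everywhere.
\<close>

lemma extremal_positive:
  assumes ext: "\<rho>\<^sup>2 = top_sq (card X) (card Y)" and u: "u \<in> X - {u\<^sub>0}"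
  shows "0 < z u"
proof (rule ccontr)
  assume "\<not> 0 < z u"
  then have "z u = 0" using nonneg(1)[of u] by simp
  then have "T + z v\<^sub>0 = 0" using extremal_row_sums(2)[OF ext u] by simp
  then have zero: "T = 0" "z v\<^sub>0 = 0" using sums_nonneg nonneg(1)[of v\<^sub>0] by linarith+
  have "0 < \<rho>\<^sup>2" using ext two by (simp add: top_sq_ge)
  then have "z u' = 0" if "u' \<in> X" for u'
    using zero that extremal_row_sums[OF ext] by (cases "u' = u\<^sub>0") auto
  then have "S = 0" "z u\<^sub>0 = 0" using in_parts by auto
  then show False using zero sums_nonzero by simp
qed

text \<open>
  In each row, \<open>B\<close> and the comparison matrix give the same value on \<open>z\<close>, and \<open>B\<close> is
  bounded by the comparison matrix; so they agree in every column in which \<open>z\<close> is positive.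
\<close>

lemma extremal_entry_if_positive:
  assumes ext: "\<rho>\<^sup>2 = top_sq (card X) (card Y)"
    and "u \<in> X" "v \<in> Y" "(u, v) \<noteq> (u\<^sub>0, v\<^sub>0)" and pos: "0 < z v"
  shows "B u v = 1"
proof (cases "u = u\<^sub>0")
  case False
  then have "(\<Sum>v\<in>Y. B u v * z v) = (\<Sum>v\<in>Y. z v)"
    using assms extremal_row_sums(2)[OF ext] by (simp add: eigen_X total_Y)
  then show ?thesis
    using assms finite le_one nonneg by (intro coefficient_one_if_total[of Y "B u" z v]) auto
next
  case True
  have "(\<Sum>v\<in>Y. B u\<^sub>0 v * z v) = (\<Sum>v\<in>Y - {v\<^sub>0}. B u\<^sub>0 v * z v) - z v\<^sub>0"
    using finite in_parts negative by (subst sum.remove[of _ v\<^sub>0]) auto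
  then have "(\<Sum>v\<in>Y - {v\<^sub>0}. B u\<^sub>0 v * z v) = T"
    using extremal_row_sums(1)[OF ext] in_parts by (simp add: eigen_X)
  then show ?thesis
    using True assms finite le_one nonneg
    by (intro coefficient_one_if_total[of "Y - {v\<^sub>0}" "B u" z v]) auto
qed

text \<open>
  The vector \<open>z\<close> can vanish at \<open>u\<^sub>0\<close> or at \<open>v\<^sub>0\<close>, but a position other than \<open>(u\<^sub>0, v\<^sub>0)\<close> has a row
  other than \<open>u\<^sub>0\<close> or a column other than \<open>v\<^sub>0\<close>, where \<open>z\<close> is positive.
\<close>

lemma extremal_entry:
  assumes ext: "\<rho>\<^sup>2 = top_sq (card X) (card Y)"
    and uv: "u \<in> X" "v \<in> Y" "(u, v) \<noteq> (u\<^sub>0, v\<^sub>0)"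
  shows "B u v = 1"
proof -
  interpret tr: bipartite_eigenvector Y X v\<^sub>0 u\<^sub>0 "\<lambda>u v. B v u" z \<rho> by (rule transposed)
  have ext': "\<rho>\<^sup>2 = top_sq (card Y) (card X)" using ext by (simp add: top_sq_commute)
  show ?thesis
  proof (cases "v = v\<^sub>0")
    case True
    then have "0 < z u" using uv by (intro extremal_positive[OF ext]) auto
    then show ?thesis using uv by (intro tr.extremal_entry_if_positive[OF ext']) auto
  next
    case False
    then have "0 < z v" using uv by (intro tr.extremal_positive[OF ext']) auto
    then show ?thesis using uv by (intro extremal_entry_if_positive[OF ext]) auto
  qed
qed

end

section \<open>Real eigenvectors of signed graphs\<close>

definition signed_adjacency :: "'a pair_pre_digraph \<Rightarrow> ('a set \<Rightarrow> int) \<Rightarrow> 'a \<Rightarrow> 'a \<Rightarrow> real" where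
  "signed_adjacency G \<sigma> u v = (if (u, v) \<in> parcs G then of_int (\<sigma> {u, v}) else 0)"

lemma adjacency_eq_signed_adjacency: "adjacency G \<sigma> u v = of_real (signed_adjacency G \<sigma> u v)"
  by (simp add: adjacency_def signed_adjacency_def)

context signed_graph
begin

lemma arcs_sym: "(u, v) \<in> parcs G \<longleftrightarrow> (v, u) \<in> parcs G"
  using pair_sym_arcs by (auto simp: symmetric_def dest: symD)

lemma arc_in_verts: "(u, v) \<in> parcs G \<Longrightarrow> u \<in> pverts G \<and> v \<in> pverts G"
  using arc_fst_in_verts arc_snd_in_verts by fastforce

lemma signed_adjacency_sym: "signed_adjacency G \<sigma> u v = signed_adjacency G \<sigma> v u"
  by (simp add: signed_adjacency_def arcs_sym[of u v] insert_commute)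

lemma vertex_list: "distinct (vertex_list G)" "set (vertex_list G) = pverts G"
proof -
  have "\<exists>vs. distinct vs \<and> set vs = pverts G"
    using finite_distinct_list[OF pair_finite_verts] by auto
  then have "distinct (vertex_list G) \<and> set (vertex_list G) = pverts G"
    unfolding vertex_list_def by (rule someI_ex)
  then show "distinct (vertex_list G)" "set (vertex_list G) = pverts G" by auto
qed

lemma eigenvalue_iff:
  "eigenvalue (adjacency_matrix G \<sigma> (vertex_list G)) k \<longleftrightarrow>
    (\<exists>x. (\<exists>v\<in>pverts G. x v \<noteq> 0) \<and>
      (\<forall>u\<in>pverts G. (\<Sum>v\<in>pverts G. of_real (signed_adjacency G \<sigma> u v) * x v) = k * x u))"
  unfolding eigenvalue_adjacency_matrix_iff[OF vertex_list(1)] vertex_list(2)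
    adjacency_eq_signed_adjacency ..

lemma adjacency_matrix_carrier:
  "adjacency_matrix G \<sigma> (vertex_list G) \<in> carrier_mat (card (pverts G)) (card (pverts G))"
  using distinct_card[OF vertex_list(1)] by (simp add: adjacency_matrix_def vertex_list(2))

lemma eigenvalue_le_rho:
  fixes x :: "'a \<Rightarrow> real"
  assumes nz: "v \<in> pverts G" "x v \<noteq> 0"
    and eig: "\<And>u. u \<in> pverts G \<Longrightarrow> (\<Sum>v\<in>pverts G. signed_adjacency G \<sigma> u v * x v) = k * x u"
  shows "\<bar>k\<bar> \<le> rho G \<sigma>"
proof -
  have "(\<Sum>v\<in>pverts G. of_real (signed_adjacency G \<sigma> u v) * complex_of_real (x v))
      = of_real k * of_real (x u)" if "u \<in> pverts G" for u
    using arg_cong[OF eig[OF that], of complex_of_real] by simp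
  then have "eigenvalue (adjacency_matrix G \<sigma> (vertex_list G)) (of_real k)"
    unfolding eigenvalue_iff using nz by (intro exI[of _ "\<lambda>v. of_real (x v)"]) auto
  moreover have "0 < card (pverts G)" using nz pair_finite_verts by (auto simp: card_gt_0_iff)
  moreover have "\<bar>k\<bar> = norm (complex_of_real k)" by simp
  ultimately show ?thesis
    unfolding rho_def
    by (intro spectral_radius_mem_max(2)[OF adjacency_matrix_carrier])
      (auto simp: spectrum_def simp del: norm_of_real)
qed

text \<open>
  A complex eigenvector \<open>x\<close> for an eigenvalue \<open>l\<close> of largest modulus has \<open>l \<parallel>x\<parallel>\<^sup>2 = x\<^sup>* A x\<close>, which is
  real because \<open>A\<close> is real symmetric.  So \<open>l\<close> is real, and the real and imaginary parts of \<open>x\<close>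
  satisfy the eigenvalue equation; one of them is nonzero.
\<close>

lemma obtain_rho_eigenvector:
  assumes "pverts G \<noteq> {}"
  obtains k and x :: "'a \<Rightarrow> real" where "\<bar>k\<bar> = rho G \<sigma>" "\<exists>v\<in>pverts G. x v \<noteq> 0"
    "\<And>u. u \<in> pverts G \<Longrightarrow> (\<Sum>v\<in>pverts G. signed_adjacency G \<sigma> u v * x v) = k * x u"
proof -
  let ?V = "pverts G" and ?a = "signed_adjacency G \<sigma>"
  have "0 < card ?V" using assms pair_finite_verts by (auto simp: card_gt_0_iff)
  from spectral_radius_mem_max(1)[OF adjacency_matrix_carrier this]
  obtain l where l: "eigenvalue (adjacency_matrix G \<sigma> (vertex_list G)) l" "norm l = rho G \<sigma>"
    by (auto simp: spectrum_def rho_def)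
  then obtain x where nz: "\<exists>v\<in>?V. x v \<noteq> 0"
    and eig: "\<And>u. u \<in> ?V \<Longrightarrow> (\<Sum>v\<in>?V. of_real (?a u v) * x v) = l * x u"
    unfolding eigenvalue_iff by blast
  define N where "N = (\<Sum>u\<in>?V. cnj (x u) * x u)"
  have "N = of_real (\<Sum>u\<in>?V. (norm (x u))\<^sup>2)"
    unfolding N_def of_real_sum by (intro sum.cong refl) (metis complex_norm_square mult.commute)
  moreover have "(\<Sum>u\<in>?V. (norm (x u))\<^sup>2) \<noteq> 0"
    using nz pair_finite_verts by (subst sum_nonneg_eq_0_iff) auto
  ultimately obtain M :: real where "N = of_real M" "M \<noteq> 0" by blast
  then have N: "N \<noteq> 0" "cnj N = N" by simp_all
  have form: "l * N = (\<Sum>u\<in>?V. \<Sum>v\<in>?V. cnj (x u) * of_real (?a u v) * x v)"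
    by (simp add: N_def sum_distrib_left mult.assoc eig[symmetric] mult.left_commute[of l])
  also have "\<dots> = (\<Sum>v\<in>?V. \<Sum>u\<in>?V. cnj (x u) * of_real (?a u v) * x v)" by (rule sum.swap)
  also have "\<dots> = cnj (\<Sum>u\<in>?V. \<Sum>v\<in>?V. cnj (x u) * of_real (?a u v) * x v)"
  proof -
    have "cnj (x u) * of_real (?a u v) * x v = cnj (cnj (x v) * of_real (?a v u) * x u)" for u v
      using signed_adjacency_sym[of u v] by (simp add: mult_ac)
    then show ?thesis unfolding cnj_sum by (intro sum.cong refl)
  qed
  also have "\<dots> = cnj (l * N)" by (simp only: form)
  finally have "cnj l = l" using N by simp
  then obtain k where k: "l = of_real k" by (metis Reals_cnj_iff Reals_cases)
  have "(\<Sum>v\<in>?V. ?a u v * Re (x v)) = k * Re (x u)" "(\<Sum>v\<in>?V. ?a u v * Im (x v)) = k * Im (x u)"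
    if "u \<in> ?V" for u
    using arg_cong[OF eig[OF that], of Re] arg_cong[OF eig[OF that], of Im] by (simp_all add: k)
  moreover have "(\<exists>v\<in>?V. Re (x v) \<noteq> 0) \<or> (\<exists>v\<in>?V. Im (x v) \<noteq> 0)"
    using nz by (auto simp: complex_eq_iff)
  moreover have "\<bar>k\<bar> = rho G \<sigma>" using l k by simp
  ultimately show ?thesis
    using that[of k "\<lambda>v. Re (x v)"] that[of k "\<lambda>v. Im (x v)"] by blast
qed

text \<open>
  Changing the sign of an eigenvector on one part of a bipartite graph negates the eigenvalue, so
  \<open>rho G \<sigma>\<close> itself, and not only its negative, is an eigenvalue.  Switching by the signs of the
  entries of an eigenvector replaces it by its absolute value.
\<close>

lemma obtain_nonneg_switched_eigenvector:
  assumes parts: "pverts G = X \<union> Y" "X \<inter> Y = {}" "parcs G \<subseteq> X \<times> Y \<union> Y \<times> X"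
    and nonempty: "pverts G \<noteq> {}"
  obtains \<theta> :: "'a \<Rightarrow> int" and z :: "'a \<Rightarrow> real" where
    "\<And>v. \<theta> v \<in> {-1, 1}" "\<And>v. 0 \<le> z v" "\<exists>v\<in>pverts G. z v \<noteq> 0"
    "\<And>u. u \<in> pverts G \<Longrightarrow>
      (\<Sum>v\<in>pverts G. of_int (\<theta> u) * signed_adjacency G \<sigma> u v * of_int (\<theta> v) * z v) = rho G \<sigma> * z u"
proof -
  let ?V = "pverts G" and ?a = "signed_adjacency G \<sigma>"
  obtain k and x :: "'a \<Rightarrow> real" where k: "\<bar>k\<bar> = rho G \<sigma>" and nz: "\<exists>v\<in>?V. x v \<noteq> 0"
    and eig: "\<And>u. u \<in> ?V \<Longrightarrow> (\<Sum>v\<in>?V. ?a u v * x v) = k * x u"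
    by (rule obtain_rho_eigenvector[OF nonempty]) blast
  define y where "y v = (if v \<in> Y \<and> k < 0 then - x v else x v)" for v
  have eig_y: "(\<Sum>v\<in>?V. ?a u v * y v) = rho G \<sigma> * y u" if u: "u \<in> ?V" for u
  proof -
    have "?a u v * y v = (if u \<in> X \<and> k < 0 then - 1 else 1) * (?a u v * x v)" for v
      using parts u by (auto simp: y_def signed_adjacency_def)
    then have "(\<Sum>v\<in>?V. ?a u v * y v) = (if u \<in> X \<and> k < 0 then - 1 else 1) * (k * x u)"
      by (simp only: sum_distrib_left[symmetric] eig[OF u])
    also have "\<dots> = rho G \<sigma> * y u"
      unfolding k[symmetric] using parts u by (auto simp: y_def abs_if)
    finally show ?thesis .
  qed
  define \<theta> where "\<theta> v = (if y v < 0 then - 1 else 1 :: int)" for v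
  have \<theta>_y: "of_int (\<theta> v) * \<bar>y v\<bar> = y v" "of_int (\<theta> v) * y v = \<bar>y v\<bar>" for v
    by (auto simp: \<theta>_def)
  show ?thesis
  proof (rule that[of \<theta> "\<lambda>v. \<bar>y v\<bar>"])
    fix u assume u: "u \<in> ?V"
    have "(\<Sum>v\<in>?V. of_int (\<theta> u) * ?a u v * of_int (\<theta> v) * \<bar>y v\<bar>) = of_int (\<theta> u) * (\<Sum>v\<in>?V. ?a u v * y v)"
      by (simp add: sum_distrib_left mult.assoc \<theta>_y)
    also have "\<dots> = rho G \<sigma> * \<bar>y u\<bar>"
      by (simp add: eig_y[OF u] mult.left_commute \<theta>_y)
    finally show "(\<Sum>v\<in>?V. of_int (\<theta> u) * ?a u v * of_int (\<theta> v) * \<bar>y v\<bar>) = rho G \<sigma> * \<bar>y u\<bar>" .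
  next
    show "\<exists>v\<in>?V. \<bar>y v\<bar> \<noteq> 0" using nz by (auto simp: y_def)
  qed (auto simp: \<theta>_def)
qed

section \<open>Balance and switching\<close>

text \<open>
  If \<open>\<sigma> {u, v} = \<theta> u * \<theta> v\<close> on all edges, the signs along a walk telescope to the product of
  \<open>\<theta>\<close> at its two ends, which is \<open>1\<close> for a closed walk.
\<close>

lemma balanced_if_switching_all_positive:
  assumes \<theta>: "\<And>v. \<theta> v \<in> {-1, 1 :: int}" and pos: "\<And>u v. (u, v) \<in> parcs G \<Longrightarrow> \<theta> u * \<sigma> {u, v} * \<theta> v = 1"
  shows "balanced G \<sigma>"
proof -
  let ?neg = "\<lambda>(u, v). \<sigma> {u, v} = -1"
  have sq: "\<theta> v * \<theta> v = 1" for v using \<theta>[of v] by auto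
  have sign: "\<sigma> {u, v} = \<theta> u * \<theta> v" if "(u, v) \<in> parcs G" for u v
    using pos[OF that] \<theta>[of u] \<theta>[of v] by auto
  have walk: "(-1) ^ length (filter ?neg p) = \<theta> u * \<theta> v"
    if "pcas u p v" "set p \<subseteq> parcs G" for u v p
    using that
  proof (induction p arbitrary: u)
    case Nil
    then show ?case by (simp add: sq)
  next
    case (Cons e p)
    obtain w where e: "e = (u, w)" using Cons.prems by (cases e) auto
    then have "(-1) ^ length (filter ?neg p) = \<theta> w * \<theta> v"
      using Cons by auto
    moreover have "\<sigma> {u, w} = \<theta> u * \<theta> w" using sign Cons.prems e by auto
    ultimately show ?case
      using \<theta>[of u] \<theta>[of w] \<theta>[of v] e by auto
  qed
  have "even (length (filter ?neg p))" if cycle: "graph_cycle G p" for p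
  proof -
    obtain u where "pcas u p u" "set p \<subseteq> parcs G"
      using cycle unfolding graph_cycle_def pre_digraph.cycle_def pre_digraph.awalk_def by auto
    then have "(-1 :: int) ^ length (filter ?neg p) = 1" using walk sq by metis
    then show ?thesis by (metis neg_one_odd_power one_neq_neg_one)
  qed
  then show ?thesis by (simp add: balanced_def)
qed

text \<open>
  Switching each leaf by the sign of its edge to the centre makes all edges positive.
\<close>

lemma balanced_if_star_graph:
  assumes star: "\<And>u v. (u, v) \<in> parcs G \<Longrightarrow> (u = c) \<noteq> (v = c)"
  shows "balanced G \<sigma>"
proof (rule balanced_if_switching_all_positive)
  let ?\<theta> = "\<lambda>v. if (c, v) \<in> parcs G then \<sigma> {c, v} else 1"
  show "?\<theta> v \<in> {-1, 1}" for v using signature by auto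
  show "?\<theta> u * \<sigma> {u, v} * ?\<theta> v = 1" if uv: "(u, v) \<in> parcs G" for u v
  proof -
    have "(c, c) \<notin> parcs G" using star by blast
    then show ?thesis
      using star[OF uv] signature[OF uv] uv arcs_sym[of u v] by (auto simp: insert_commute)
  qed
qed

lemma two_le_card_part:
  assumes parts: "pverts G = X \<union> Y" "X \<inter> Y = {}" "parcs G \<subseteq> X \<times> Y \<union> Y \<times> X"
    and unbalanced: "\<not> balanced G \<sigma>"
  shows "2 \<le> card X"
proof (rule ccontr)
  assume "\<not> 2 \<le> card X"
  moreover have "finite X" using pair_finite_verts parts by simp
  ultimately have "card X = 0 \<or> card X = 1" by linarith
  then obtain c where "X \<subseteq> {c}" using \<open>finite X\<close> by (auto simp: card_1_singleton_iff)
  then have "balanced G \<sigma>"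
    using parts by (intro balanced_if_star_graph[of c]) blast
  then show False using unbalanced by simp
qed

text \<open>
  The core of the argument: the bound on \<open>rho G \<sigma>\<close> in terms of the sizes of the parts, together with
  the shape that \<open>G\<close> has after switching if the bound is attained.
\<close>

lemma unbalanced_bipartite_extremal:
  assumes parts: "pverts G = X \<union> Y" "X \<inter> Y = {}" "parcs G \<subseteq> X \<times> Y \<union> Y \<times> X"
    and unbalanced: "\<not> balanced G \<sigma>"
  obtains \<theta> :: "'a \<Rightarrow> int" and u\<^sub>0 v\<^sub>0 where
    "\<And>v. \<theta> v \<in> {-1, 1}" "u\<^sub>0 \<in> X" "v\<^sub>0 \<in> Y"
    "(rho G \<sigma>)\<^sup>2 \<le> top_sq (card X) (card Y)"
    "\<And>u v. (rho G \<sigma>)\<^sup>2 = top_sq (card X) (card Y) \<Longrightarrow> u \<in> X \<Longrightarrow> v \<in> Y \<Longrightarrow>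
      (u, v) \<in> parcs G \<and> \<theta> u * \<sigma> {u, v} * \<theta> v = (if u = u\<^sub>0 \<and> v = v\<^sub>0 then -1 else 1)"
proof -
  let ?V = "pverts G" and ?a = "signed_adjacency G \<sigma>"
  have parts': "pverts G = Y \<union> X" "Y \<inter> X = {}" "parcs G \<subseteq> Y \<times> X \<union> X \<times> Y" using parts by auto
  have two: "2 \<le> card X" "2 \<le> card Y"
    using two_le_card_part[OF parts unbalanced] two_le_card_part[OF parts' unbalanced] by auto
  have fin: "finite X" "finite Y" using pair_finite_verts parts by auto
  have "?V \<noteq> {}" using two parts by auto
  then obtain \<theta> :: "'a \<Rightarrow> int" and z :: "'a \<Rightarrow> real" where
    \<theta>: "\<And>v. \<theta> v \<in> {-1, 1}" and z: "\<And>v. 0 \<le> z v" "\<exists>v\<in>?V. z v \<noteq> 0" and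
    eig: "\<And>u. u \<in> ?V \<Longrightarrow> (\<Sum>v\<in>?V. of_int (\<theta> u) * ?a u v * of_int (\<theta> v) * z v) = rho G \<sigma> * z u"
    by (rule obtain_nonneg_switched_eigenvector[OF parts]) blast
  define B where "B u v = of_int (\<theta> u) * ?a u v * of_int (\<theta> v)" for u v
  have B_sym: "B u v = B v u" for u v by (simp add: B_def signed_adjacency_sym[of u v])
  have B_arc: "B u v = of_int (\<theta> u * \<sigma> {u, v} * \<theta> v)" if "(u, v) \<in> parcs G" for u v
    using that by (simp add: B_def signed_adjacency_def)
  have B_values: "B u v \<in> {-1, 0, 1}" for u v
    using \<theta>[of u] \<theta>[of v] signature[of u v] by (auto simp: B_def signed_adjacency_def)
  have B_same_part: "B u v = 0" if "u \<in> X \<and> v \<in> X \<or> u \<in> Y \<and> v \<in> Y" for u v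
    using that parts by (auto simp: B_def signed_adjacency_def)
  have "\<exists>u v. (u, v) \<in> parcs G \<and> \<theta> u * \<sigma> {u, v} * \<theta> v \<noteq> 1"
    using unbalanced balanced_if_switching_all_positive[of \<theta>] \<theta> by blast
  then obtain u v where uv: "(u, v) \<in> parcs G" "\<theta> u * \<sigma> {u, v} * \<theta> v \<noteq> 1" by blast
  then have "\<theta> u * \<sigma> {u, v} * \<theta> v = -1"
    using \<theta>[of u] \<theta>[of v] signature[of u v] by auto
  then have "B u v = -1" using B_arc[OF uv(1)] by simp
  then obtain u\<^sub>0 v\<^sub>0 where neg: "u\<^sub>0 \<in> X" "v\<^sub>0 \<in> Y" "B u\<^sub>0 v\<^sub>0 = -1"
    using uv(1) parts B_sym[of u v] by (metis SigmaD1 SigmaD2 Un_iff subset_iff)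
  have row: "(\<Sum>v\<in>?V. B u v * z v) = (\<Sum>v\<in>X. B u v * z v) + (\<Sum>v\<in>Y. B u v * z v)" for u
    using fin parts by (simp add: sum.union_disjoint)
  interpret bipartite_eigenvector X Y u\<^sub>0 v\<^sub>0 B z "rho G \<sigma>"
  proof
    show "B u v \<le> 1" for u v using B_values[of u v] by auto
    show "0 \<le> rho G \<sigma>"
      using obtain_rho_eigenvector[OF \<open>?V \<noteq> {}\<close>] by (metis abs_ge_zero)
    show "(\<Sum>v\<in>Y. B u v * z v) = rho G \<sigma> * z u" if "u \<in> X" for u
      using eig[of u] row[of u] that parts by (simp add: B_def[symmetric] B_same_part)
    show "(\<Sum>u\<in>X. B u v * z u) = rho G \<sigma> * z v" if "v \<in> Y" for v
      using eig[of v] row[of v] that parts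
      by (simp add: B_def[symmetric] B_same_part B_sym[of _ v])
  qed (use fin two neg z parts in auto)
  show ?thesis
  proof (rule that[OF \<theta> neg(1,2) eigenvalue_bound])
    fix u v assume ext: "(rho G \<sigma>)\<^sup>2 = top_sq (card X) (card Y)" and uv: "u \<in> X" "v \<in> Y"
    have B: "B u v = (if u = u\<^sub>0 \<and> v = v\<^sub>0 then -1 else 1)"
      using extremal_entry[OF ext uv] neg by auto
    then have arc: "(u, v) \<in> parcs G"
      by (auto simp: B_def signed_adjacency_def split: if_splits)
    then have "real_of_int (\<theta> u * \<sigma> {u, v} * \<theta> v) = of_int (if u = u\<^sub>0 \<and> v = v\<^sub>0 then -1 else 1)"
      using B B_arc[OF arc] by simp
    then show "(u, v) \<in> parcs G \<and> \<theta> u * \<sigma> {u, v} * \<theta> v = (if u = u\<^sub>0 \<and> v = v\<^sub>0 then -1 else 1)"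
      using arc by (simp only: of_int_eq_iff simp_thms)
  qed
qed

end

section \<open>The extremal graph\<close>

lemma obtain_pointed_bijection:
  assumes "finite A" "finite B" "card A = card B" "a \<in> A" "b \<in> B"
  obtains f where "bij_betw f A B" "f a = b"
proof -
  have "card (A - {a}) = card (B - {b})" using assms by simp
  then obtain g where g: "bij_betw g (A - {a}) (B - {b})"
    using assms finite_same_card_bij[of "A - {a}" "B - {b}"] by auto
  have "bij_betw (g(a := b)) (insert a (A - {a})) (insert b (B - {b}))"
    using g by (auto simp: bij_betw_def inj_on_def)
  then show ?thesis using assms by (intro that[of "g(a := b)"]) (simp_all add: insert_absorb)
qed

lemma parts_complete_bipartite:
  "pverts (complete_bipartite r s) = Inl ` {1..r} \<union> Inr ` {1..s}"
  "Inl ` {1..r} \<inter> Inr ` {1..s} = {}"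
  "parcs (complete_bipartite r s) \<subseteq> Inl ` {1..r} \<times> Inr ` {1..s} \<union> Inr ` {1..s} \<times> Inl ` {1..r}"
  by (auto simp: complete_bipartite_def)

lemma signed_adjacency_star:
  "signed_adjacency (complete_bipartite r s) star_signature (Inl i) (Inl i') = 0"
  "signed_adjacency (complete_bipartite r s) star_signature (Inr j) (Inr j') = 0"
  "i \<in> {1..r} \<Longrightarrow> j \<in> {1..s} \<Longrightarrow>
    signed_adjacency (complete_bipartite r s) star_signature (Inl i) (Inr j) = (if i = 1 \<and> j = 1 then -1 else 1)"
  "i \<in> {1..r} \<Longrightarrow> j \<in> {1..s} \<Longrightarrow>
    signed_adjacency (complete_bipartite r s) star_signature (Inr j) (Inl i) = (if i = 1 \<and> j = 1 then -1 else 1)"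
  by (auto simp: signed_adjacency_def complete_bipartite_def star_signature_def doubleton_eq_iff)

lemma sum_first_and_others:
  fixes x y :: real
  assumes "1 \<le> m"
  shows "(\<Sum>j\<in>{1..m}. if j = 1 then x else y) = x + (real m - 1) * y"
  using assms by (subst sum.remove[of _ 1]) (auto simp: of_nat_diff)

lemma star_eigenvector:
  assumes rs: "2 \<le> r" "2 \<le> s"
  obtains z where "\<exists>v\<in>pverts (complete_bipartite r s). z v \<noteq> 0"
    "\<And>u. u \<in> pverts (complete_bipartite r s) \<Longrightarrow>
      (\<Sum>v\<in>pverts (complete_bipartite r s). signed_adjacency (complete_bipartite r s) star_signature u v * z v)
        = sqrt (top_sq r s) * z u"
proof -
  let ?K = "complete_bipartite r s" and ?\<rho> = "sqrt (top_sq r s)"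
  let ?a = "signed_adjacency ?K star_signature"
  have "2 \<le> real r" "2 \<le> real s" using rs by auto
  then obtain a b c d where nz: "a \<noteq> 0 \<or> b \<noteq> 0 \<or> c \<noteq> 0 \<or> d \<noteq> 0" and eq:
    "?\<rho> * a = (real s - 1) * d - b" "?\<rho> * c = (real s - 1) * d + b"
    "?\<rho> * b = (real r - 1) * c - a" "?\<rho> * d = (real r - 1) * c + a"
    by (rule quotient_eigenvector) auto
  define z :: "nat + nat \<Rightarrow> real" where
    "z = case_sum (\<lambda>i. if i = 1 then a else c) (\<lambda>j. if j = 1 then b else d)"
  have sum: "(\<Sum>v\<in>pverts ?K. h v) = (\<Sum>i\<in>{1..r}. h (Inl i)) + (\<Sum>j\<in>{1..s}. h (Inr j))"
    for h :: "nat + nat \<Rightarrow> real"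
    unfolding parts_complete_bipartite(1)
    by (subst sum.union_disjoint) (auto simp: sum.reindex)
  show ?thesis
  proof (rule that[of z])
    have "Inl 1 \<in> pverts ?K" "Inl 2 \<in> pverts ?K" "Inr 1 \<in> pverts ?K" "Inr 2 \<in> pverts ?K"
      using rs by (auto simp: parts_complete_bipartite(1))
    moreover have "z (Inl 1) = a" "z (Inl 2) = c" "z (Inr 1) = b" "z (Inr 2) = d"
      by (simp_all add: z_def)
    ultimately show "\<exists>v\<in>pverts ?K. z v \<noteq> 0" using nz by metis
  next
    fix u assume "u \<in> pverts ?K"
    then consider i where "u = Inl i" "i \<in> {1..r}" | j where "u = Inr j" "j \<in> {1..s}"
      by (auto simp: parts_complete_bipartite(1))
    then show "(\<Sum>v\<in>pverts ?K. ?a u v * z v) = ?\<rho> * z u"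
    proof cases
      case 1
      have "(\<Sum>v\<in>pverts ?K. ?a u v * z v) = (\<Sum>j\<in>{1..s}. if j = 1 then (if i = 1 then - b else b) else d)"
        unfolding sum using 1 by (auto simp: signed_adjacency_star z_def intro!: sum.cong)
      also have "\<dots> = ?\<rho> * z u"
        using 1 rs eq by (simp add: sum_first_and_others z_def del: One_nat_def)
      finally show ?thesis .
    next
      case 2
      have "(\<Sum>v\<in>pverts ?K. ?a u v * z v) = (\<Sum>i\<in>{1..r}. if i = 1 then (if j = 1 then - a else a) else c)"
        unfolding sum using 2 by (auto simp: signed_adjacency_star z_def intro!: sum.cong)
      also have "\<dots> = ?\<rho> * z u"
        using 2 rs eq by (simp add: sum_first_and_others z_def del: One_nat_def)
      finally show ?thesis .
    qed
  qed
qed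

text \<open>
  An eigenvector of \<open>H\<close> becomes one of \<open>G\<close> when it is pulled back along the isomorphism and its
  entries are multiplied by the switching function.
\<close>

lemma (in signed_graph) eigenvalue_le_rho_if_switching_isomorphic:
  assumes iso: "switching_isomorphic G \<sigma> H \<tau>" and nz: "\<exists>w\<in>pverts H. z w \<noteq> 0"
    and eig: "\<And>w. w \<in> pverts H \<Longrightarrow> (\<Sum>w'\<in>pverts H. signed_adjacency H \<tau> w w' * z w') = k * z w"
  shows "\<bar>k\<bar> \<le> rho G \<sigma>"
proof -
  obtain \<tau>' \<theta> f where \<theta>: "\<And>w. w \<in> pverts H \<Longrightarrow> \<theta> w \<in> {-1, 1 :: int}"
    and sw: "\<And>w w'. (w, w') \<in> parcs H \<Longrightarrow> \<tau> {w, w'} = \<theta> w * \<tau>' {w, w'} * \<theta> w'"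
    and f: "bij_betw f (pverts G) (pverts H)"
    and arcs: "\<And>u v. u \<in> pverts G \<Longrightarrow> v \<in> pverts G \<Longrightarrow> (u, v) \<in> parcs G \<longleftrightarrow> (f u, f v) \<in> parcs H"
    and sign: "\<And>u v. (u, v) \<in> parcs G \<Longrightarrow> \<sigma> {u, v} = \<tau>' {f u, f v}"
    using iso unfolding switching_isomorphic_def switching_equivalent_def signed_isomorphic_def
    by fast
  have f_in: "f u \<in> pverts H" if "u \<in> pverts G" for u using f that by (auto simp: bij_betw_def)
  define x where "x u = of_int (\<theta> (f u)) * z (f u)" for u
  have entry: "signed_adjacency G \<sigma> u v * x v = of_int (\<theta> (f u)) * (signed_adjacency H \<tau> (f u) (f v) * z (f v))"
    if "u \<in> pverts G" "v \<in> pverts G" for u v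
  proof -
    have "\<theta> (f u) \<in> {-1, 1}" "\<theta> (f v) \<in> {-1, 1}" using that f_in \<theta> by auto
    then show ?thesis
      using arcs[OF that] sign[of u v] sw[of "f u" "f v"]
      by (auto simp: x_def signed_adjacency_def)
  qed
  obtain w where w: "w \<in> pverts H" "z w \<noteq> 0" using nz by auto
  then obtain v where v: "v \<in> pverts G" "w = f v" using f by (auto simp: bij_betw_def)
  have "x v \<noteq> 0" using w v \<theta>[OF w(1)] by (auto simp: x_def)
  moreover have "(\<Sum>v\<in>pverts G. signed_adjacency G \<sigma> u v * x v) = k * x u" if u: "u \<in> pverts G" for u
  proof -
    have "(\<Sum>v\<in>pverts G. signed_adjacency G \<sigma> u v * x v)
        = of_int (\<theta> (f u)) * (\<Sum>v\<in>pverts G. signed_adjacency H \<tau> (f u) (f v) * z (f v))"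
      using entry[OF u] by (simp add: sum_distrib_left)
    also have "(\<Sum>v\<in>pverts G. signed_adjacency H \<tau> (f u) (f v) * z (f v)) = k * z (f u)"
      unfolding sum.reindex_bij_betw[OF f, of "\<lambda>w'. signed_adjacency H \<tau> (f u) w' * z w'"]
      by (rule eig[OF f_in[OF u]])
    finally show ?thesis by (simp add: x_def mult_ac)
  qed
  ultimately show ?thesis by (rule eigenvalue_le_rho[OF v(1)])
qed

lemma (in signed_graph) rho_ge_if_switching_isomorphic_star:
  assumes "switching_isomorphic G \<sigma> (complete_bipartite r s) star_signature" "2 \<le> r" "2 \<le> s"
  shows "sqrt (top_sq r s) \<le> rho G \<sigma>"
proof -
  obtain z where "\<exists>v\<in>pverts (complete_bipartite r s). z v \<noteq> 0"
    "\<And>u. u \<in> pverts (complete_bipartite r s) \<Longrightarrow>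
      (\<Sum>v\<in>pverts (complete_bipartite r s). signed_adjacency (complete_bipartite r s) star_signature u v * z v)
        = sqrt (top_sq r s) * z u"
    by (rule star_eigenvector[OF assms(2,3)]) blast
  then have "\<bar>sqrt (top_sq r s)\<bar> \<le> rho G \<sigma>"
    by (rule eigenvalue_le_rho_if_switching_isomorphic[OF assms(1)])
  then show ?thesis by linarith
qed

lemma switching_isomorphic_refl:
  assumes "signed_graph H \<tau>"
  shows "switching_isomorphic H \<tau> H \<tau>"
  unfolding switching_isomorphic_def switching_equivalent_def signed_isomorphic_def
proof (intro exI conjI)
  show "\<forall>v\<in>pverts H. (1 :: int) \<in> {-1, 1}" by simp
  show "bij_betw id (pverts H) (pverts H)" by simp
qed (use assms in auto)

lemma rho_star:
  assumes rs: "2 \<le> r" "2 \<le> s"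
  shows "rho (complete_bipartite r s) star_signature = sqrt (top_sq r s)"
proof (rule antisym)
  interpret K: signed_graph "complete_bipartite r s" star_signature by (rule signed_graph_star)
  have card: "card (Inl ` {1..r} :: (nat + nat) set) = r" "card (Inr ` {1..s} :: (nat + nat) set) = s"
    by (simp_all add: card_image)
  have "(rho (complete_bipartite r s) star_signature)\<^sup>2 \<le> top_sq r s"
    using K.unbalanced_bipartite_extremal[OF parts_complete_bipartite not_balanced_star[OF rs]]
    unfolding card by metis
  then show "rho (complete_bipartite r s) star_signature \<le> sqrt (top_sq r s)" by (rule real_le_rsqrt)
  show "sqrt (top_sq r s) \<le> rho (complete_bipartite r s) star_signature"
    by (rule K.rho_ge_if_switching_isomorphic_star[OF switching_isomorphic_refl[OF signed_graph_star] rs])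
qed

text \<open>
  The bijection sends the ends of the remaining negative edge to the ends of the negative edge of
  \<open>star_signature\<close> and the other vertices of each part arbitrarily.
\<close>

lemma (in signed_graph) switching_isomorphic_star_if_extremal:
  assumes parts: "pverts G = X \<union> Y" "X \<inter> Y = {}" "parcs G \<subseteq> X \<times> Y \<union> Y \<times> X"
    and unbalanced: "\<not> balanced G \<sigma>" and ext: "(rho G \<sigma>)\<^sup>2 = top_sq (card X) (card Y)"
  shows "switching_isomorphic G \<sigma> (complete_bipartite (card X) (card Y)) star_signature"
proof -
  let ?K = "complete_bipartite (card X) (card Y)"
  obtain \<theta> u\<^sub>0 v\<^sub>0 where \<theta>: "\<And>v. \<theta> v \<in> {-1, 1 :: int}" and base: "u\<^sub>0 \<in> X" "v\<^sub>0 \<in> Y" and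
    complete: "\<And>u v. u \<in> X \<Longrightarrow> v \<in> Y \<Longrightarrow>
      (u, v) \<in> parcs G \<and> \<theta> u * \<sigma> {u, v} * \<theta> v = (if u = u\<^sub>0 \<and> v = v\<^sub>0 then -1 else 1)"
    using unbalanced_bipartite_extremal[OF parts unbalanced] ext by metis
  have fin: "finite X" "finite Y" using pair_finite_verts parts by auto
  have ne: "1 \<in> {1..card X}" "1 \<in> {1..card Y}"
    using fin base by (auto simp: Suc_le_eq card_gt_0_iff)
  obtain g where g: "bij_betw g X {1..card X}" "g u\<^sub>0 = 1"
    using obtain_pointed_bijection[of X "{1..card X}" u\<^sub>0 1] fin base ne by auto
  obtain h where h: "bij_betw h Y {1..card Y}" "h v\<^sub>0 = 1"
    using obtain_pointed_bijection[of Y "{1..card Y}" v\<^sub>0 1] fin base ne by auto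
  define f where "f w = (if w \<in> X then Inl (g w) else Inr (h w))" for w
  have f_X: "f u = Inl (g u)" if "u \<in> X" for u using that by (simp add: f_def)
  have f_Y: "f v = Inr (h v)" if "v \<in> Y" for v using that parts by (auto simp: f_def)
  have "bij_betw f X (Inl ` {1..card X})"
    using g by (auto simp: bij_betw_def inj_on_def f_X)
  moreover have "bij_betw f Y (Inr ` {1..card Y})"
    using h by (auto simp: bij_betw_def inj_on_def f_Y)
  ultimately have f: "bij_betw f (pverts G) (pverts ?K)"
    unfolding parts(1) parts_complete_bipartite(1) by (rule bij_betw_combine) auto
  have arcs: "(u, v) \<in> parcs G \<longleftrightarrow> (f u, f v) \<in> parcs ?K" if "u \<in> pverts G" "v \<in> pverts G" for u v
  proof -
    have "g w \<in> {1..card X}" if "w \<in> X" for w using g that by (auto simp: bij_betw_def)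
    moreover have "h w \<in> {1..card Y}" if "w \<in> Y" for w using h that by (auto simp: bij_betw_def)
    ultimately show ?thesis
      using that complete[of u v] complete[of v u] arcs_sym[of u v] parts
      by (auto simp: complete_bipartite_def f_X f_Y)
  qed
  have star_f: "star_signature {f u, f v} = (if u = u\<^sub>0 \<and> v = v\<^sub>0 then -1 else 1)"
    if "u \<in> X" "v \<in> Y" for u v
  proof -
    have "g u = 1 \<longleftrightarrow> u = u\<^sub>0" using g base that by (metis bij_betw_inv_into_left)
    moreover have "h v = 1 \<longleftrightarrow> v = v\<^sub>0" using h base that by (metis bij_betw_inv_into_left)
    ultimately show ?thesis
      using that by (simp add: star_signature_def f_X f_Y doubleton_eq_iff)
  qed
  have sign_XY: "\<sigma> {u, v} = \<theta> u * \<theta> v * star_signature {f u, f v}" if "u \<in> X" "v \<in> Y" for u v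
    unfolding star_f[OF that] complete[OF that, THEN conjunct2, symmetric]
    using \<theta>[of u] \<theta>[of v] by auto
  have sign: "\<sigma> {u, v} = \<theta> u * \<theta> v * star_signature {f u, f v}" if "(u, v) \<in> parcs G" for u v
    using that parts sign_XY[of u v] sign_XY[of v u] by (auto simp: insert_commute mult.commute)
  define \<theta>' where "\<theta>' w = \<theta> (inv_into (pverts G) f w)" for w
  have \<theta>'_f: "\<theta>' (f u) = \<theta> u" if "u \<in> pverts G" for u
    using bij_betw_inv_into_left[OF f that] by (simp add: \<theta>'_def)
  have \<theta>': "\<theta>' w \<in> {-1, 1}" for w by (simp add: \<theta>'_def \<theta>[simplified])
  \<comment> \<open>a signature is a function of the unordered edge, so the two switching factors are a product over
    the edge as a set\<close>
  define \<tau> where "\<tau> e = (\<Prod>w\<in>e. \<theta>' w) * star_signature e" for e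
  interpret K: signed_graph ?K star_signature by (rule signed_graph_star)
  have \<tau>: "\<tau> {w, w'} = \<theta>' w * \<theta>' w' * star_signature {w, w'}" if "(w, w') \<in> parcs ?K" for w w'
    using K.pair_no_loops[OF that] by (simp add: \<tau>_def)
  have "signed_graph ?K \<tau>"
  proof
    fix w w' assume "(w, w') \<in> parcs ?K"
    then show "\<tau> {w, w'} \<in> {-1, 1}"
      using \<tau> K.signature \<theta>'[of w] \<theta>'[of w'] by fastforce
  qed
  moreover have "switching_equivalent ?K \<tau> star_signature"
    unfolding switching_equivalent_def
  proof (intro exI conjI ballI)
    show "\<theta>' w \<in> {-1, 1}" for w by (rule \<theta>')
    show "case e of (w, w') \<Rightarrow> star_signature {w, w'} = \<theta>' w * \<tau> {w, w'} * \<theta>' w'" if "e \<in> parcs ?K" for e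
    proof (cases e)
      case (Pair w w')
      then show ?thesis using that \<tau>[of w w'] \<theta>'[of w] \<theta>'[of w'] by auto
    qed
  qed
  moreover have "signed_isomorphic G \<sigma> ?K \<tau>"
    unfolding signed_isomorphic_def
  proof (intro exI conjI ballI)
    show "bij_betw f (pverts G) (pverts ?K)" by (rule f)
    show "(u, v) \<in> parcs G \<longleftrightarrow> (f u, f v) \<in> parcs ?K" if "u \<in> pverts G" "v \<in> pverts G" for u v
      by (rule arcs[OF that])
    show "case e of (u, v) \<Rightarrow> \<sigma> {u, v} = \<tau> {f u, f v}" if "e \<in> parcs G" for e
    proof (cases e)
      case (Pair u v)
      then have "u \<in> pverts G" "v \<in> pverts G" using arc_in_verts that by auto
      then show ?thesis
        using Pair that sign[of u v] \<tau>[of "f u" "f v"] arcs[of u v] by (simp add: \<theta>'_f)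
    qed
  qed
  ultimately show ?thesis unfolding switching_isomorphic_def by blast
qed

theorem theorem22:
  fixes G :: "'a pair_pre_digraph" and \<sigma> :: "'a set \<Rightarrow> int" and n r s :: nat
  assumes "signed_graph G \<sigma>"
    and "Digraph_Component.connected (with_proj G)"
    and "bipartite G"
    and "\<not> balanced G \<sigma>"
    and "n = card (pverts G)"
    and "r = nat \<lfloor>real n / 2\<rfloor>"
    and "s = nat \<lceil>real n / 2\<rceil>"
  shows "rho G \<sigma> \<le> rho (complete_bipartite r s) star_signature \<and>
    (rho G \<sigma> = rho (complete_bipartite r s) star_signature \<longleftrightarrow>
      switching_isomorphic G \<sigma> (complete_bipartite r s) star_signature)"
proof -
  interpret signed_graph G \<sigma> by fact
  obtain X Y where parts: "pverts G = X \<union> Y" "X \<inter> Y = {}" "parcs G \<subseteq> X \<times> Y \<union> Y \<times> X"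
    using \<open>bipartite G\<close> unfolding bipartite_def by blast
  have parts': "pverts G = Y \<union> X" "Y \<inter> X = {}" "parcs G \<subseteq> Y \<times> X \<union> X \<times> Y" using parts by auto
  note unbalanced = \<open>\<not> balanced G \<sigma>\<close>
  have two: "2 \<le> card X" "2 \<le> card Y"
    using two_le_card_part[OF parts unbalanced] two_le_card_part[OF parts' unbalanced] by auto
  have rs: "r = n div 2" "s = n - n div 2"
    unfolding \<open>r = _\<close> \<open>s = _\<close> by linarith+
  have "card X + card Y = n"
    using pair_finite_verts parts \<open>n = _\<close> by (simp add: card_Un_disjoint)
  then have sum: "card X + card Y = r + s" and bal: "r \<le> s" "s \<le> r + 1" and ge: "2 \<le> r" "2 \<le> s"
    using rs two by linarith+
  note sizes = top_sq_le_equal_parts[OF sum bal two]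
  have star: "rho (complete_bipartite r s) star_signature = sqrt (top_sq r s)"
    by (rule rho_star[OF ge])
  have sq: "(rho G \<sigma>)\<^sup>2 \<le> top_sq (card X) (card Y)"
    using unbalanced_bipartite_extremal[OF parts unbalanced] by metis
  then have le: "rho G \<sigma> \<le> sqrt (top_sq r s)"
    using sizes(1) by (intro real_le_rsqrt) simp
  have "switching_isomorphic G \<sigma> (complete_bipartite r s) star_signature" if "rho G \<sigma> = sqrt (top_sq r s)"
  proof -
    have "0 < top_sq r s" using ge by (intro top_sq_ge) auto
    then have ext: "(rho G \<sigma>)\<^sup>2 = top_sq r s" using that by simp
    then have "card X = r \<and> card Y = s \<or> card X = s \<and> card Y = r"
      using sizes sq by (intro sizes(2)) linarith
    then show ?thesis
      using switching_isomorphic_star_if_extremal[OF parts unbalanced]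
        switching_isomorphic_star_if_extremal[OF parts' unbalanced] ext by auto
  qed
  moreover have "rho G \<sigma> = sqrt (top_sq r s)"
    if "switching_isomorphic G \<sigma> (complete_bipartite r s) star_signature"
    using rho_ge_if_switching_isomorphic_star[OF that ge] le by simp
  ultimately show ?thesis using le star by auto
qed

end
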